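(* Let $n\ge 2$, let $a_1,\ldots,a_n$ be positive integers with $\gcd(a_1,a_2)=1$, and let $S=\langle a_1,\ldots,a_n\rangle$ and $Q=\langle a_1,a_2\rangle$. If $a_i+a_j\in Q$ for all $i,j\in\{3,\ldots,n\}$ (including $i=j$), then the type of $S$ satisfies $t(S)\le n-1$.
   Context: For positive integers $a_1,\ldots,a_n$ with $\gcd(a_1,\ldots,a_n)=1$, $\langle a_1,\ldots,a_n\rangle=\{\sum_{i=1}^n\lambda_i a_i : \lambda_i\in\mathbb{Z},\ \lambda_i\ge 0\}$ is the numerical semigroup generated by $a_1,\ldots,a_n$. For a numerical semigroup $S$, the set of pseudo-Frobenius numbers is $T(S)=\{x\in\mathbb{N} : x\notin S,\ x+s\in S \text{ for all } s\in S \text{ with } s>0\}$ (with $\mathbb{N}$ the non-negative integers), and the type of $S$ is $t(S)=|T(S)|$. *)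

theory Defs
  imports Complex_Main "HOL-Number_Theory.Cong"
begin

definition gen_semigroup :: "(nat \<Rightarrow> nat) \<Rightarrow> nat \<Rightarrow> nat set" where
  "gen_semigroup a n = {\<Sum>i=1..n. l i * a i | l :: nat \<Rightarrow> nat. True}"

definition pseudo_frobenius :: "nat set \<Rightarrow> nat set" where
  "pseudo_frobenius S = {x. x \<notin> S \<and> (\<forall>s\<in>S. s > 0 \<longrightarrow> x + s \<in> S)}"

text \<open>
  The type is a genuine cardinality only where \<open>pseudo_frobenius S\<close> is finite
  (\<open>card\<close> is \<open>0\<close> on infinite sets); \<open>finite_pseudo_frobenius\<close> below gives
  finiteness whenever the first two generators are coprime.
\<close>
definition semigroup_type :: "nat set \<Rightarrow> nat" where
  "semigroup_type S = card (pseudo_frobenius S)"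

lemma large_in_gen_semigroup:
  assumes "n \<ge> 2" "a 2 > 0" "coprime (a 1) (a 2)" "x \<ge> a 1 * a 2"
  shows "x \<in> gen_semigroup a n"
proof -
  obtain w where w: "[a 1 * w = 1] (mod a 2)"
    using assms(3) cong_solve_coprime_nat by auto
  define u where "u = (w * x) mod a 2"
  have "[a 1 * u = a 1 * (w * x)] (mod a 2)"
    unfolding u_def by (simp add: cong_def mod_mult_right_eq)
  also have "[a 1 * (w * x) = x] (mod a 2)"
    using cong_mult[OF w cong_refl[of x]] by (simp add: mult.assoc)
  finally have c: "[a 1 * u = x] (mod a 2)" .
  have "u < a 2" using assms(2) by (simp add: u_def)
  then have le: "a 1 * u \<le> x"
    using assms(4) by (meson le_trans less_imp_le mult_le_mono2)
  then have "a 2 dvd x - a 1 * u"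
    using c by (metis cong_altdef_nat cong_sym)
  then obtain v where v: "x = u * a 1 + v * a 2"
    using le by (metis dvd_def le_add_diff_inverse mult.commute)
  define l where "l = (\<lambda>i::nat. if i = 1 then u else if i = 2 then v else 0)"
  have "(\<Sum>i=1..n. l i * a i) = (\<Sum>i\<in>{1,2}. l i * a i)"
    using assms(1) by (intro sum.mono_neutral_right) (auto simp: l_def)
  also have "\<dots> = x" by (simp add: l_def v)
  finally show ?thesis unfolding gen_semigroup_def by blast
qed

lemma finite_pseudo_frobenius:
  assumes "n \<ge> 2" "a 2 > 0" "coprime (a 1) (a 2)"
  shows "finite (pseudo_frobenius (gen_semigroup a n))"
proof (rule finite_subset)
  show "pseudo_frobenius (gen_semigroup a n) \<subseteq> {..<a 1 * a 2}"
    using large_in_gen_semigroup[of n a, OF assms]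
    by (auto simp: pseudo_frobenius_def) (meson not_le)
qed simp

end

theory Submission
  imports Defs
begin

text \<open>
  Two distinct pseudo-Frobenius numbers \<open>x < y\<close> are incongruent modulo \<open>a\<^sub>2\<close>, as otherwise
  \<open>y = x + k a\<^sub>2 \<in> S\<close>. The hypothesis gives \<open>S = C + Q\<close> with \<open>C = {0, a\<^sub>3, \<dots>, a\<^sub>n}\<close>. For a
  pseudo-Frobenius number \<open>x\<close> write \<open>x + a\<^sub>1 = c + \<lambda> a\<^sub>1 + \<mu> a\<^sub>2\<close> accordingly; then \<open>\<lambda> = 0\<close>, as
  otherwise \<open>x \<in> S\<close>. So \<open>x + a\<^sub>1\<close> lies in one of the at most \<open>n - 1\<close> residue classes of \<open>C\<close>
  modulo \<open>a\<^sub>2\<close>.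
\<close>

lemma gen_semigroupI: "(\<Sum>i=1..n. l i * a i) \<in> gen_semigroup a n"
  unfolding gen_semigroup_def by blast

lemma gen_semigroup_add:
  assumes "x \<in> gen_semigroup a n" "y \<in> gen_semigroup a n"
  shows "x + y \<in> gen_semigroup a n"
proof -
  obtain l m where "x = (\<Sum>i=1..n. l i * a i)" "y = (\<Sum>i=1..n. m i * a i)"
    using assms unfolding gen_semigroup_def by blast
  then have "x + y = (\<Sum>i=1..n. (l i + m i) * a i)"
    by (simp add: sum.distrib algebra_simps)
  then show ?thesis by (simp only: gen_semigroupI)
qed

lemma gen_semigroup_multiple:
  assumes "i \<in> {1..n}"
  shows "k * a i \<in> gen_semigroup a n"
proof -
  have "(\<Sum>j=1..n. (if j = i then k else 0) * a j) = (\<Sum>j\<in>{1..n}. if j = i then k * a j else 0)"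
    by (intro sum.cong) auto
  also have "\<dots> = k * a i" using assms by simp
  finally show ?thesis by (metis gen_semigroupI)
qed

text \<open>Serves as an induction principle for the semigroup: every element is built up from 0 by
  adding one generator at a time.\<close>

lemma gen_semigroup_subset:
  assumes "0 \<in> T" and closed: "\<And>t i. t \<in> T \<Longrightarrow> i \<in> {1..n} \<Longrightarrow> t + a i \<in> T"
  shows "gen_semigroup a n \<subseteq> T"
proof -
  have mult: "t + k * a i \<in> T" if "t \<in> T" "i \<in> {1..n}" for t k i
  proof (induction k)
    case (Suc k)
    then show ?case using closed[of "t + k * a i" i] that by (simp add: ac_simps)
  qed (use that in simp)
  \<comment> \<open>Induction over partial sums; the bound \<open>m \<le> n\<close> keeps each new
    index in the range where \<open>closed\<close> is available.\<close>
  have "(\<Sum>i=1..m. l i * a i) \<in> T" if "m \<le> n" for l m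
    using that by (induction m) (use assms(1) mult in auto)
  then show ?thesis unfolding gen_semigroup_def by blast
qed

lemma gen_semigroup_two: "gen_semigroup a 2 = {u * a 1 + v * a 2 | u v. True}"
proof -
  have sum2: "(\<Sum>i=1..2. l i * a i) = l 1 * a 1 + l 2 * a 2" for l :: "nat \<Rightarrow> nat"
    by (simp add: numeral_2_eq_2)
  have "u * a 1 + v * a 2 \<in> gen_semigroup a 2" for u v
    by (intro gen_semigroup_add gen_semigroup_multiple) auto
  moreover have "\<exists>u v. x = u * a 1 + v * a 2" if x: "x \<in> gen_semigroup a 2" for x
  proof -
    obtain l where "x = (\<Sum>i=1..2. l i * a i)" using x by (auto simp: gen_semigroup_def)
    then show ?thesis using sum2[of l] by metis
  qed
  ultimately show ?thesis by auto
qed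

text \<open>Sums with at most one summand of index at least 3 already absorb every generator, so
  \<open>gen_semigroup_subset\<close> applies to the set \<open>T\<close> of these sums.\<close>

lemma gen_semigroup_decompose:
  assumes sums: "\<And>i j. i \<in> {3..n} \<Longrightarrow> j \<in> {3..n} \<Longrightarrow> a i + a j \<in> gen_semigroup a 2"
    and "x \<in> gen_semigroup a n"
  obtains c u v where "c \<in> insert 0 (a ` {3..n})" "x = c + u * a 1 + v * a 2"
proof -
  define C where "C = insert 0 (a ` {3..n})"
  define T where "T = {c + u * a 1 + v * a 2 | c u v. c \<in> C}"
  have TI: "c + u * a 1 + v * a 2 \<in> T" if "c \<in> C" for c u v
    using that unfolding T_def by blast
  have "gen_semigroup a n \<subseteq> T"
  proof (rule gen_semigroup_subset)
    show "0 \<in> T" using TI[of 0 0 0] by (simp add: C_def)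
  next
    fix t i assume "t \<in> T" and i: "i \<in> {1..n}"
    then obtain c u v where c: "c \<in> C" and t: "t = c + u * a 1 + v * a 2"
      unfolding T_def by blast
    consider "i = 1" | "i = 2" | "i \<in> {3..n}" using i by fastforce
    then show "t + a i \<in> T"
    proof cases
      case 1
      then show ?thesis using TI[OF c, of "Suc u" v] by (simp add: t ac_simps)
    next
      case 2
      then show ?thesis using TI[OF c, of u "Suc v"] by (simp add: t ac_simps)
    next
      case 3
      \<comment> \<open>If \<open>c = 0\<close>, the free slot takes \<open>a i\<close>. If it holds
        some \<open>a j\<close>, the hypothesis turns \<open>a j + a i\<close> into an element of Q
        and the slot becomes 0 again.\<close>
      show ?thesis
      proof (cases "c = 0")
        case True
        then show ?thesis using TI[of "a i" u v] 3 by (simp add: C_def t ac_simps)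
      next
        case False
        then obtain j where "j \<in> {3..n}" "c = a j" using c by (auto simp: C_def)
        then obtain p q where "c + a i = p * a 1 + q * a 2"
          using sums[of j i] 3 by (auto simp: gen_semigroup_two)
        then have "t + a i = 0 + (u + p) * a 1 + (v + q) * a 2"
          by (simp add: t algebra_simps)
        then show ?thesis using TI[of 0 "u + p" "v + q"] by (simp add: C_def)
      qed
    qed
  qed
  then show thesis using assms(2) that unfolding T_def C_def by blast
qed

text \<open>The shift \<open>d\<close> cancels in the congruence; it is included so that the lemma
  fits the map \<open>f\<close> below, with \<open>d = a 1\<close> and \<open>i = 2\<close>.\<close>

lemma inj_on_mod_pseudo_frobenius:
  assumes "i \<in> {1..n}"
  shows "inj_on (\<lambda>x. (x + d) mod a i) (pseudo_frobenius (gen_semigroup a n))"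
proof (rule linorder_inj_onI')
  fix x y
  assume x: "x \<in> pseudo_frobenius (gen_semigroup a n)"
    and y: "y \<in> pseudo_frobenius (gen_semigroup a n)" and "x < y"
  show "(x + d) mod a i \<noteq> (y + d) mod a i"
  proof
    assume "(x + d) mod a i = (y + d) mod a i"
    then have "a i dvd y - x"
      using \<open>x < y\<close> mod_eq_dvd_iff_nat[of "x + d" "y + d" "a i"] by simp
    then obtain k where k: "y - x = k * a i" by (metis dvdE mult.commute)
    \<comment> \<open>Since \<open>x < y\<close>, the element \<open>k * a i = y - x\<close> is
      positive, as the pseudo-Frobenius property of \<open>x\<close> requires.\<close>
    then have "x + k * a i \<in> gen_semigroup a n"
      using x \<open>x < y\<close> gen_semigroup_multiple[OF assms, of k a]
      by (auto simp: pseudo_frobenius_def)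
    moreover have "x + k * a i = y" using k \<open>x < y\<close> by linarith
    ultimately show False using y by (simp add: pseudo_frobenius_def)
  qed
qed

theorem theorem1:
  fixes a :: "nat \<Rightarrow> nat" and n :: nat
  assumes "n \<ge> 2"
    and "\<And>i. i \<in> {1..n} \<Longrightarrow> a i > 0"
    and "gcd (a 1) (a 2) = 1"
    and "\<And>i j. i \<in> {3..n} \<Longrightarrow> j \<in> {3..n} \<Longrightarrow> a i + a j \<in> gen_semigroup a 2"
  shows "semigroup_type (gen_semigroup a n) \<le> n - 1"
proof -
  define S where "S = gen_semigroup a n"
  define C where "C = insert 0 (a ` {3..n})"
  define f where "f = (\<lambda>x. (x + a 1) mod a 2)"
  have gen: "k * a i \<in> S" if "i \<in> {1..n}" for i k
    using gen_semigroup_multiple that unfolding S_def .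
  have add: "x + y \<in> S" if "x \<in> S" "y \<in> S" for x y
    using gen_semigroup_add that unfolding S_def .
  have a1: "a 1 \<in> S" "a 1 > 0" using gen[of 1 1] assms(1,2) by auto
  \<comment> \<open>That 0 lies in \<open>S\<close> comes from the zero multiple of
    \<open>a 1\<close>.\<close>
  have C: "C \<subseteq> S"
    using gen[of 1 0] gen[of _ 1] assms(1) by (auto simp: C_def)
  have "f x \<in> (\<lambda>c. c mod a 2) ` C" if x: "x \<in> pseudo_frobenius S" for x
  proof -
    have "x + a 1 \<in> S" and "x \<notin> S" using x a1 by (auto simp: pseudo_frobenius_def)
    then obtain c u v where c: "c \<in> C" and eq: "x + a 1 = c + u * a 1 + v * a 2"
      using gen_semigroup_decompose[OF assms(4)] unfolding S_def C_def by metis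
    have "u = 0"
    proof (rule ccontr)
      assume "u \<noteq> 0"
      then obtain w where "u = Suc w" by (cases u) auto
      then have "x = c + w * a 1 + v * a 2" using eq by simp
      moreover have "c + w * a 1 + v * a 2 \<in> S"
        using c C assms(1) by (intro add gen) auto
      ultimately show False using \<open>x \<notin> S\<close> by simp
    qed
    then have "x + a 1 = c + v * a 2" using eq by simp
    then have "f x = c mod a 2" by (simp only: f_def mod_mult_self1)
    then show ?thesis using c by blast
  qed
  moreover have "inj_on f (pseudo_frobenius S)"
    unfolding f_def S_def using assms(1) by (intro inj_on_mod_pseudo_frobenius) auto
  moreover have "finite C" by (simp add: C_def)
  ultimately have "card (pseudo_frobenius S) \<le> card ((\<lambda>c. c mod a 2) ` C)"
    by (intro card_inj_on_le) auto
  also have "\<dots> \<le> card C" using \<open>finite C\<close> by (rule card_image_le)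
  \<comment> \<open>Only an inequality, since generators may repeat.\<close>
  also have "\<dots> \<le> Suc (card {3..n})"
    unfolding C_def using card_image_le[of "{3..n}" a] by (simp add: card_insert_if)
  \<comment> \<open>For \<open>n = 2\<close> the interval is empty and both sides are 1.\<close>
  also have "\<dots> = n - 1" using assms(1) by simp
  finally show ?thesis by (simp add: semigroup_type_def S_def)
qed

end
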